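(* Let $A,B$ be infinite sets of nonnegative integers such that $r_{A,B}(n)=1$ for every nonnegative integer $n$. Then \[ \liminf_{x\to\infty}\frac{A(x)B(x)}{x}=1 \quad\text{and}\quad \frac32\le \limsup_{x\to\infty}\frac{A(x)B(x)}{x}\le 2. \] Moreover, the constants $\frac32$ and $2$ are best possible: there exist infinite sets $A,B$ of nonnegative integers with $r_{A,B}(n)=1$ for all $n\ge 0$ and $\limsup_{x\to\infty}A(x)B(x)/x=\frac32$, and there exist such sets with $\limsup_{x\to\infty}A(x)B(x)/x=2$.
   Context: For nonempty sets $A,B$ of nonnegative integers and an integer $n$, $r_{A,B}(n)$ denotes the number of pairs $(a,b)\in A\times B$ with $a+b=n$. For a set $S$ of nonnegative integers, $S(x)$ denotes the number of elements of $S$ not exceeding $x$. *)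

theory Defs
  imports Complex_Main "HOL-Library.Extended_Real"
begin

definition rep_count :: "nat set \<Rightarrow> nat set \<Rightarrow> nat \<Rightarrow> nat" where
  "rep_count A B n = card {(a, b). a \<in> A \<and> b \<in> B \<and> a + b = n}"

definition counting :: "nat set \<Rightarrow> real \<Rightarrow> nat" where
  "counting S x = card {s \<in> S. real s \<le> x}"

text \<open>The ratio is embedded in the extended reals so that its limits inferior and superior are
  taken in a complete lattice and carry no implicit boundedness assumption.\<close>

definition count_ratio :: "nat set \<Rightarrow> nat set \<Rightarrow> real \<Rightarrow> ereal" where
  "count_ratio A B x = ereal (real (counting A x) * real (counting B x) / x)"

end

theory Submission
  imports Defs
begin

text \<open>
  Write \<open>g(n) = A(n) B(n)\<close>. All sums of pairs counted by \<open>g(n)\<close> are distinct, at most \<open>2 n\<close>, and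
  include \<open>0, \<dots>, n\<close>, so \<open>n + 1 \<le> g(n) \<le> 2 n + 1\<close>. If \<open>1 \<in> A\<close> and \<open>b\<close> is the least positive element
  of \<open>B\<close>, then \<open>A = {0, \<dots>, b - 1} + b A'\<close> and \<open>B = b B'\<close> (de Bruijn), where \<open>A', B'\<close> is again such a
  pair and \<open>1 \<in> B'\<close>. The ratio \<open>g(n) / (n + 1)\<close> at \<open>n = b q + b - 1\<close> equals that of \<open>A', B'\<close> at \<open>q\<close>;
  hence extremal values at small arguments propagate to arbitrarily large ones, which gives the
  lower limit and the bound \<open>3 / 2\<close>. The upper limits \<open>3 / 2\<close> and \<open>2\<close> are attained by mixed radix
  systems with all radices 2 and with unbounded radices, respectively.
\<close>

section \<open>Counting product and block operations\<close>

definition cnt :: "nat set \<Rightarrow> nat \<Rightarrow> nat" where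
  "cnt S n = card (S \<inter> {..n})"

definition pair_count :: "nat set \<Rightarrow> nat set \<Rightarrow> nat \<Rightarrow> nat" where
  "pair_count A B n = cnt A n * cnt B n"

text \<open>For \<open>b > 0\<close> this is \<open>{0, ..., b - 1} + b A\<close>, encoded by the
  quotient so that membership depends on \<open>n div b\<close> alone.\<close>

definition inflate :: "nat \<Rightarrow> nat set \<Rightarrow> nat set" where
  "inflate b A = {n. n div b \<in> A}"

definition dilate :: "nat \<Rightarrow> nat set \<Rightarrow> nat set" where
  "dilate b B = {n. b dvd n \<and> n div b \<in> B}"

abbreviation complements :: "nat set \<Rightarrow> nat set \<Rightarrow> bool" where
  "complements A B \<equiv> \<forall>n. rep_count A B n = 1"

section \<open>Elementary properties of complementing pairs\<close>

lemma pair_count_commute: "pair_count A B n = pair_count B A n"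
  by (simp add: pair_count_def)

lemma rep_count_commute: "rep_count A B n = rep_count B A n"
  unfolding rep_count_def
  by (rule bij_betw_same_card[of prod.swap], rule bij_betw_byWitness[of _ prod.swap]) auto

lemma complements_commute: "complements A B \<Longrightarrow> complements B A"
  by (simp add: rep_count_commute)

lemma complements_ex:
  assumes "complements A B"
  obtains a b where "a \<in> A" "b \<in> B" "a + b = n"
proof -
  have "card {(a, b). a \<in> A \<and> b \<in> B \<and> a + b = n} = 1"
    using assms by (simp add: rep_count_def)
  then show ?thesis using that by (auto simp: card_1_singleton_iff)
qed

lemma complements_unique:
  assumes "complements A B" "a \<in> A" "b \<in> B" "a' \<in> A" "b' \<in> B" "a + b = a' + b'"
  shows "a = a' \<and> b = b'"
proof -
  have "card {(x, y). x \<in> A \<and> y \<in> B \<and> x + y = a + b} = 1"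
    using assms by (simp add: rep_count_def)
  then obtain p where p: "{(x, y). x \<in> A \<and> y \<in> B \<and> x + y = a + b} = {p}"
    by (auto simp: card_1_singleton_iff)
  have "(a, b) \<in> {p}" "(a', b') \<in> {p}"
    unfolding p[symmetric] using assms by auto
  then show ?thesis by auto
qed

lemma complements_zero:
  assumes "complements A B" shows "0 \<in> A" "0 \<in> B"
  using complements_ex[OF assms, of 0] by (metis add_is_0)+

text \<open>A common element \<open>x\<close> has the two representations \<open>x + 0\<close> and
  \<open>0 + x\<close>.\<close>

lemma complements_disjoint:
  assumes "complements A B" "x \<in> A" "x \<in> B" shows "x = 0"
  using complements_unique[OF assms(1), of x 0 0 x] complements_zero[OF assms(1)] assms by simp

section \<open>Representations and counts under inflation and dilation\<close>

text \<open>The dilated summand is divisible by \<open>b\<close>, so the inflated one carries the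
  whole remainder \<open>n mod b\<close>, and the quotients add up to
  \<open>n div b\<close>.\<close>

lemma rep_count_inflate_dilate:
  assumes "b > 0"
  shows "rep_count (inflate b A) (dilate b B) n = rep_count A B (n div b)"
proof -
  have "bij_betw (\<lambda>(x, y). (b * x + n mod b, b * y))
      {(x, y). x \<in> A \<and> y \<in> B \<and> x + y = n div b}
      {(x, y). x \<in> inflate b A \<and> y \<in> dilate b B \<and> x + y = n}"
    (is "bij_betw ?f ?S ?T")
  proof (rule bij_betw_byWitness[of _ "\<lambda>(x, y). (x div b, y div b)"])
    show "?f ` ?S \<subseteq> ?T"
    proof clarsimp
      fix x y assume "x \<in> A" "y \<in> B" and xy: "x + y = n div b"
      have "b * x + n mod b + b * y = b * (x + y) + n mod b" by (simp add: algebra_simps)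
      also have "\<dots> = n" by (simp add: xy)
      finally show "b * x + n mod b \<in> inflate b A \<and> b * y \<in> dilate b B
          \<and> b * x + n mod b + b * y = n"
        using assms \<open>x \<in> A\<close> \<open>y \<in> B\<close> by (simp add: inflate_def dilate_def)
    qed
  qed (use assms in \<open>auto simp: inflate_def dilate_def\<close>)
  from bij_betw_same_card[OF this] show ?thesis by (simp add: rep_count_def)
qed

text \<open>The argument is the last point of block \<open>q\<close>, so every block up to
  \<open>q\<close> is complete and contributes \<open>b\<close> or nothing.\<close>

lemma cnt_inflate:
  assumes "b > 0"
  shows "cnt (inflate b A) (b * q + (b - 1)) = b * cnt A q"
proof -
  have "bij_betw (\<lambda>n. (n div b, n mod b)) (inflate b A \<inter> {..b * q + (b - 1)})
      ((A \<inter> {..q}) \<times> {..<b})"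
  proof (rule bij_betw_byWitness[of _ "\<lambda>(x, r). b * x + r"])
    show "(\<lambda>n. (n div b, n mod b)) ` (inflate b A \<inter> {..b * q + (b - 1)})
        \<subseteq> (A \<inter> {..q}) \<times> {..<b}"
    proof -
      have "n div b \<le> q" if "n \<le> b * q + (b - 1)" for n
      proof -
        have "n < b * Suc q" using that assms by simp
        then have "n div b < Suc q" by (simp add: less_mult_imp_div_less mult.commute)
        then show ?thesis by simp
      qed
      then show ?thesis using assms by (auto simp: inflate_def)
    qed
    show "(\<lambda>(x, r). b * x + r) ` ((A \<inter> {..q}) \<times> {..<b}) \<subseteq> inflate b A \<inter> {..b * q + (b - 1)}"
    proof -
      have "b * x + r \<le> b * q + (b - 1)" if "x \<le> q" "r < b" for x r
        using that by (intro add_mono mult_left_mono) auto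
      then show ?thesis by (auto simp: inflate_def simp del: One_nat_def)
    qed
  qed auto
  from bij_betw_same_card[OF this] show ?thesis by (simp add: cnt_def card_cartesian_product)
qed

lemma cnt_inflate_notin:
  assumes "b > 0" "q \<notin> A"
  shows "cnt (inflate b A) (b * q) = b * cnt A q"
proof -
  have "n \<le> b * q" if n: "n \<in> inflate b A" "n \<le> b * q + (b - 1)" for n
  proof (rule ccontr)
    assume "\<not> n \<le> b * q"
    then obtain r where r: "n = b * q + r" by (metis le_Suc_ex nat_le_linear)
    with n(2) assms(1) have "r < b" by simp
    then have "n div b = q" by (simp add: r)
    then show False using n(1) assms(2) by (simp add: inflate_def)
  qed
  then have "inflate b A \<inter> {..b * q} = inflate b A \<inter> {..b * q + (b - 1)}" by fastforce
  then show ?thesis using cnt_inflate[OF assms(1), of A q] by (simp add: cnt_def)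
qed

lemma cnt_dilate:
  assumes "r < b"
  shows "cnt (dilate b B) (b * q + r) = cnt B q"
proof -
  have "bij_betw ((*) b) (B \<inter> {..q}) (dilate b B \<inter> {..b * q + r})"
  proof (rule bij_betw_byWitness[of _ "\<lambda>n. n div b"])
    show "(\<lambda>n. n div b) ` (dilate b B \<inter> {..b * q + r}) \<subseteq> B \<inter> {..q}"
    proof -
      have "n div b \<le> q" if "n \<le> b * q + r" for n
      proof -
        have "n < b * Suc q" using that assms by simp
        then have "n div b < Suc q" by (simp add: less_mult_imp_div_less mult.commute)
        then show ?thesis by simp
      qed
      then show ?thesis using assms by (auto simp: dilate_def)
    qed
    show "(*) b ` (B \<inter> {..q}) \<subseteq> dilate b B \<inter> {..b * q + r}"
      using assms by (auto simp: dilate_def intro: trans_le_add1)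
  qed (use assms in \<open>auto simp: dilate_def\<close>)
  from bij_betw_same_card[OF this] show ?thesis by (simp add: cnt_def)
qed

lemma pair_count_block_end:
  assumes "b > 0"
  shows "pair_count (inflate b A) (dilate b B) (b * q + (b - 1)) = b * pair_count A B q"
  using assms by (simp only: pair_count_def cnt_inflate cnt_dilate diff_less zero_less_one mult.assoc)

text \<open>Block \<open>q\<close> of the inflated set is empty, so the block-end value is reached
  \<open>b - 1\<close> places earlier. The bound 3/2 exploits this shift.\<close>

lemma pair_count_block_start:
  assumes "b > 0" "q \<notin> A"
  shows "pair_count (inflate b A) (dilate b B) (b * q) = b * pair_count A B q"
  using assms cnt_dilate[of 0 b B q] by (simp add: pair_count_def cnt_inflate_notin)

section \<open>First bounds for the counting product\<close>

lemma pair_count_ge: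
  assumes "complements A B"
  shows "n + 1 \<le> pair_count A B n"
proof -
  have "{..n} \<subseteq> (\<lambda>(x, y). x + y) ` ((A \<inter> {..n}) \<times> (B \<inter> {..n}))"
  proof
    fix m assume m: "m \<in> {..n}"
    obtain a b where "a \<in> A" "b \<in> B" "a + b = m" using complements_ex[OF assms] .
    with m show "m \<in> (\<lambda>(x, y). x + y) ` ((A \<inter> {..n}) \<times> (B \<inter> {..n}))"
      by (intro image_eqI[of _ _ "(a, b)"]) auto
  qed
  then have "card {..n} \<le> card ((A \<inter> {..n}) \<times> (B \<inter> {..n}))"
    by (intro surj_card_le) auto
  then show ?thesis by (simp add: pair_count_def cnt_def card_cartesian_product)
qed

lemma pair_count_le:
  assumes "complements A B"
  shows "pair_count A B n \<le> 2 * n + 1"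
proof -
  have "inj_on (\<lambda>(x, y). x + y) ((A \<inter> {..n}) \<times> (B \<inter> {..n}))"
    by (auto simp: inj_on_def dest: complements_unique[OF assms])
  then have "card ((A \<inter> {..n}) \<times> (B \<inter> {..n})) \<le> card {..2 * n}"
    by (rule card_inj_on_le) auto
  then show ?thesis by (simp add: pair_count_def cnt_def card_cartesian_product)
qed

section \<open>De Bruijn's block structure\<close>

text \<open>Strong induction on the block index \<open>m\<close>: representing the points of block
  \<open>m\<close> involves summands from earlier blocks of both sets, so the claims on
  \<open>A\<close> and on \<open>B\<close> are carried together. The main case distinction is
  whether \<open>b * m\<close> is in \<open>A\<close>.\<close>

lemma inflate_blocks:
  assumes "complements A B" "b > 0" "b \<in> B" "\<And>c. c \<in> B \<Longrightarrow> 0 < c \<Longrightarrow> b \<le> c"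
  shows "\<forall>r<b. (b * m + r \<in> A \<longleftrightarrow> b * m \<in> A) \<and> (0 < r \<longrightarrow> b * m + r \<notin> B)"
proof (induction m rule: less_induct)
  case (less m)
  note unique = complements_unique[OF assms(1)]
  note zero = complements_zero[OF assms(1)]
  \<comment> \<open>The induction hypothesis in pointwise form, for any \<open>a\<close> before
    block \<open>m\<close>.\<close>
  have block: "a mod b = 0 \<or> a \<notin> B" "a \<in> A \<longleftrightarrow> a - a mod b \<in> A" if "a < b * m" for a
  proof -
    have "a div b < m" using that by (simp add: less_mult_imp_div_less mult.commute)
    then have "\<forall>r<b. (b * (a div b) + r \<in> A \<longleftrightarrow> b * (a div b) \<in> A)
        \<and> (0 < r \<longrightarrow> b * (a div b) + r \<notin> B)" by (rule less.IH)
    from this[rule_format, of "a mod b"]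
    have "(b * (a div b) + a mod b \<in> A \<longleftrightarrow> b * (a div b) \<in> A)
        \<and> (0 < a mod b \<longrightarrow> b * (a div b) + a mod b \<notin> B)" using assms(2) by auto
    then show "a mod b = 0 \<or> a \<notin> B" "a \<in> A \<longleftrightarrow> a - a mod b \<in> A"
      by (auto simp: minus_mod_eq_mult_div)
  qed
  show ?case
  proof (cases "m = 0")
    case True
    \<comment> \<open>Positive elements of \<open>B\<close> are at least \<open>b\<close>, so
      \<open>r\<close> is represented with second summand 0.\<close>
    have "r \<in> A" if "r < b" for r
    proof -
      obtain a c where "a \<in> A" "c \<in> B" "a + c = r" using complements_ex[OF assms(1)] .
      with that assms(4)[of c] show ?thesis by (cases "c = 0") auto
    qed
    then show ?thesis using True assms(2,4) zero by (metis add_0 leD mult_0_right)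
  next
    case False
    then have m: "b \<le> b * m" by simp
    show ?thesis
    proof (cases "b * m \<in> A")
      case mA: True
      \<comment> \<open>Since \<open>b - r\<close> is in \<open>A\<close> by the first block,
        \<open>b * m + b\<close> would have the second representation
        \<open>(b - r) + (b * m + r)\<close>.\<close>
      have notB: "b * m + r \<notin> B" if "0 < r" "r < b" for r
      proof
        assume "b * m + r \<in> B"
        moreover have "b - r \<in> A"
          using block(2)[of "b - r"] that m zero by (simp add: less_le_trans[OF _ m])
        ultimately show False
          using unique[of "b * m" b "b - r" "b * m + r"] mA assms(3) that m by simp
      qed
      have "b * m + r \<in> A" if r: "r < b" for r
      proof -
        obtain a c where ac: "a \<in> A" "c \<in> B" "a + c = b * m + r"
          using complements_ex[OF assms(1)] .
        \<comment> \<open>A positive \<open>c\<close> would have to be below \<open>b * m\<close>,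
          hence equal \<open>b * j\<close> with \<open>j > 0\<close>. By induction
          \<open>b * (m - j)\<close> is then in \<open>A\<close>, and
          \<open>b * (m - j) + b * j\<close> competes with \<open>b * m + 0\<close>.\<close>
        have "c = 0"
        proof (rule ccontr)
          assume "c \<noteq> 0"
          have "c \<noteq> b * m" using complements_disjoint[OF assms(1) mA] ac(2) \<open>c \<noteq> 0\<close> by auto
          moreover have "\<not> b * m < c"
          proof
            assume "b * m < c"
            then have "0 < c - b * m" "c - b * m < b" using ac(3) r by linarith+
            from notB[OF this] \<open>b * m < c\<close> ac(2) show False by simp
          qed
          ultimately have c: "c < b * m" by simp
          then have "c mod b = 0" using block(1) ac(2) by auto
          then obtain j where j: "c = b * j" by (auto simp: mod_eq_0_iff_dvd)
          have "j < m" using c j by simp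
          have a: "a = b * (m - j) + r"
          proof -
            have "b * m = b * (m - j) + b * j"
              using \<open>j < m\<close> by (simp add: right_diff_distrib')
            with ac(3) j show ?thesis by simp
          qed
          have "j > 0" using \<open>c \<noteq> 0\<close> j by simp
          then have "m - j < m" using \<open>j < m\<close> by simp
          from less.IH[OF this] r ac(1) a have "b * (m - j) \<in> A" by auto
          moreover have "b * (m - j) + b * j = b * m + 0"
            using \<open>j < m\<close> by (simp add: right_diff_distrib')
          ultimately have "b * j = 0" using unique mA ac(2) j zero by blast
          with \<open>c \<noteq> 0\<close> j show False by simp
        qed
        with ac show ?thesis by simp
      qed
      with notB mA show ?thesis by simp
    next
      case mA: False
      obtain a c where ac: "a \<in> A" "c \<in> B" "a + c = b * m" using complements_ex[OF assms(1)] .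
      have "c \<noteq> 0" using mA ac by (cases c) auto
      have "c mod b = 0" using block(1)[of c] ac by (cases "c = b * m") auto
      then obtain j where j: "c = b * j" by (auto simp: mod_eq_0_iff_dvd)
      have "b * j \<le> b * m" using ac(3) j by linarith
      then have "j \<le> m" using assms(2) by simp
      then have a: "a = b * (m - j)" using ac(3) j by (simp add: right_diff_distrib')
      have "m - j < m" using \<open>c \<noteq> 0\<close> j False by simp
      note blk = less.IH[OF this]
      \<comment> \<open>The block of \<open>a\<close> lies in \<open>A\<close>, so
        \<open>(a + r) + c\<close> represents \<open>b * m + r\<close> with
        \<open>c \<noteq> 0\<close>. Membership of \<open>b * m + r\<close> in \<open>A\<close>, or
        in \<open>B\<close> with \<open>r > 0\<close>, would give another representation.\<close>
      have "b * m + r \<notin> A \<and> (0 < r \<longrightarrow> b * m + r \<notin> B)" if "r < b" for r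
      proof -
        have "a + r \<in> A" using blk that ac(1) a by simp
        moreover have "(a + r) + c = b * m + r" using ac(3) by simp
        ultimately show ?thesis
          using unique[of "a + r" c "b * m + r" 0] unique[of "a + r" c 0 "b * m + r"]
            ac(2) zero \<open>c \<noteq> 0\<close> by auto
      qed
      with mA show ?thesis by simp
    qed
  qed
qed

text \<open>Here \<open>b\<close> is the least positive element of \<open>B\<close>, and the
  quotient sets are read off at the multiples of \<open>b\<close>. As \<open>b\<close> lies in
  \<open>B\<close>, \<open>1\<close> lies in \<open>B'\<close>: the hypothesis recurs with the two
  sets exchanged, so peeling can be iterated.\<close>

lemma complements_peel:
  assumes "complements A B" "infinite A" "infinite B" "1 \<in> A"
  obtains b A' B' where "b \<ge> 2" "A = inflate b A'" "B = dilate b B'"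
    "complements A' B'" "infinite A'" "infinite B'" "1 \<in> B'"
proof -
  define b where "b = (LEAST c. c \<in> B \<and> 0 < c)"
  obtain c where "c \<in> B" "0 < c"
    using assms(3) by (metis finite.simps infinite_nat_iff_unbounded)
  then have b: "b \<in> B \<and> 0 < b" unfolding b_def by (rule LeastI[OF conjI])
  have least: "b \<le> c" if "c \<in> B" "0 < c" for c
    unfolding b_def using that by (rule Least_le[OF conjI])
  \<comment> \<open>\<open>1\<close> already belongs to \<open>A\<close>; the resulting
    \<open>b \<ge> 2\<close> makes arguments grow when a peeling step is undone.\<close>
  have "b \<noteq> 1" using complements_disjoint[OF assms(1) assms(4)] b by auto
  with b have "b \<ge> 2" by simp
  define A' B' where "A' = {q. b * q \<in> A}" and "B' = {q. b * q \<in> B}"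
  note blocks = inflate_blocks[OF assms(1) conjunct2[OF b] conjunct1[OF b] least, rule_format]
  have "n \<in> A \<longleftrightarrow> b * (n div b) \<in> A" "n \<in> B \<Longrightarrow> b dvd n" for n
    using blocks[of "n mod b" "n div b"] b by (auto simp: mod_eq_0_iff_dvd[symmetric])
  then have A: "A = inflate b A'" and B: "B = dilate b B'"
    by (auto simp: inflate_def dilate_def A'_def B'_def)
  have "rep_count A' B' m = 1" for m
    using rep_count_inflate_dilate[of b A' B' "b * m"] b assms(1) A B by simp
  moreover have "infinite A'"
  proof
    assume "finite A'"
    then have "finite ((\<lambda>(q, r). b * q + r) ` (A' \<times> {..<b}))" by simp
    moreover have "A \<subseteq> (\<lambda>(q, r). b * q + r) ` (A' \<times> {..<b})"
    proof
      fix n assume "n \<in> A"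
      then have "n div b \<in> A'" using A by (simp add: inflate_def)
      then show "n \<in> (\<lambda>(q, r). b * q + r) ` (A' \<times> {..<b})"
        using b by (intro image_eqI[of _ _ "(n div b, n mod b)"]) auto
    qed
    ultimately show False using assms(2) finite_subset by blast
  qed
  moreover have "infinite B'"
  proof
    assume "finite B'"
    moreover have "B \<subseteq> (*) b ` B'" unfolding B by (force simp: dilate_def)
    ultimately show False using assms(3) finite_surj by blast
  qed
  moreover have "1 \<in> B'" using b by (simp add: B'_def)
  ultimately show ?thesis using that[of b A' B'] \<open>b \<ge> 2\<close> A B by simp
qed

section \<open>Arguments with extreme ratio\<close>

lemma complements_one:
  assumes "complements A B" shows "1 \<in> A \<or> 1 \<in> B"
proof -
  obtain a b where "a \<in> A" "b \<in> B" "a + b = 1" using complements_ex[OF assms] .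
  then show ?thesis by (auto simp: add_is_1)
qed

lemma pair_count_zero:
  assumes "complements A B" shows "pair_count A B 0 = 1"
proof -
  have "A \<inter> {0} = {0}" "B \<inter> {0} = {0}" using complements_zero[OF assms] by auto
  then show ?thesis by (simp add: pair_count_def cnt_def)
qed

text \<open>Equality at \<open>n\<close> for the peeled pair passes to
  \<open>b * n + (b - 1)\<close>, because both sides are multiplied by \<open>b\<close>. Each step
  raises the argument by at least 1, starting from 0. Peeling exchanges the sets, hence the
  generalization over them.\<close>

lemma pair_count_tight_aux:
  assumes "complements A B" "infinite A" "infinite B" "1 \<in> A"
  shows "\<exists>n\<ge>N. pair_count A B n = n + 1"
  using assms
proof (induction N arbitrary: A B)
  case 0
  then show ?case using pair_count_zero by auto
next
  case (Suc N)
  obtain b A' B' where p: "b \<ge> 2" "A = inflate b A'" "B = dilate b B'"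
    "complements A' B'" "infinite A'" "infinite B'" "1 \<in> B'"
    using complements_peel[OF Suc.prems] .
  obtain n where n: "n \<ge> N" "pair_count A' B' n = n + 1"
    using Suc.IH[OF complements_commute[OF p(4)] p(6,5,7)] pair_count_commute by metis
  have "pair_count A B (b * n + (b - 1)) = b * (n + 1)"
    using pair_count_block_end[of b A' B' n] p n by simp
  moreover have "b * (n + 1) = b * n + (b - 1) + 1" using p(1) by simp
  moreover have "Suc N \<le> b * n + (b - 1)"
  proof -
    have "1 * n \<le> b * n" using p(1) by (intro mult_right_mono) auto
    then show ?thesis using n p(1) by linarith
  qed
  ultimately show ?case by metis
qed

lemma pair_count_tight:
  assumes "complements A B" "infinite A" "infinite B"
  shows "\<exists>n\<ge>N. pair_count A B n = n + 1"
  using complements_one[OF assms(1)] pair_count_tight_aux[OF assms]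
    pair_count_tight_aux[OF complements_commute[OF assms(1)] assms(3,2)]
  unfolding pair_count_commute[of B A] by blast

lemma cnt_ge:
  assumes "F \<subseteq> S" "F \<subseteq> {..n}" shows "card F \<le> cnt S n"
  unfolding cnt_def using assms by (intro card_mono) auto

text \<open>The sets \<open>{0, ..., b - 1}\<close> and \<open>{0, b}\<close> are already contained
  in the two factors. This makes \<open>b\<close> an argument of ratio at least 2.\<close>

lemma pair_count_first_dilated:
  assumes "b > 0" "0 \<in> A" "0 \<in> B" "1 \<in> B"
  shows "2 * b \<le> pair_count (inflate b A) (dilate b B) b"
proof -
  have "card {..<b} \<le> cnt (inflate b A) b"
    using assms by (intro cnt_ge) (auto simp: inflate_def)
  moreover have "card {0, b} \<le> cnt (dilate b B) b"
    using assms by (intro cnt_ge) (auto simp: dilate_def)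
  ultimately have "b * 2 \<le> cnt (inflate b A) b * cnt (dilate b B) b"
    using assms(1) by (intro mult_mono) auto
  then show ?thesis by (simp add: pair_count_def mult.commute)
qed

text \<open>The constants 2 and 1 in the second alternative reproduce themselves under a peeling step
  with \<open>b = 2\<close>, where the roles of the two sets alternate. A step with \<open>b \<ge> 3\<close> turns the
  bound with constant 1 into the first alternative, which survives every further step.\<close>

lemma pair_count_large_aux:
  assumes "complements A B" "infinite A" "infinite B" "1 \<in> A"
  shows "(\<exists>n>N. 3 * n + 3 \<le> 2 * pair_count A B n) \<or>
    ((\<exists>n>N. n \<in> B \<and> 3 * n + 2 \<le> 2 * pair_count A B n) \<and>
     (\<exists>n>N. n \<in> A \<and> 3 * n + 1 \<le> 2 * pair_count A B n))"
  using assms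
proof (induction N arbitrary: A B)
  case 0
  obtain b A' B' where p: "b \<ge> 2" "A = inflate b A'" "B = dilate b B'"
    "complements A' B'" "infinite A'" "infinite B'" "1 \<in> B'"
    using complements_peel[OF 0] .
  \<comment> \<open>The witnesses are \<open>n = b\<close>, where
    \<open>4 * b \<ge> 3 * b + 2\<close> by \<open>b \<ge> 2\<close>, and \<open>n = 1\<close>,
    where the product is at least 2.\<close>
  have "2 * b \<le> pair_count A B b"
    using pair_count_first_dilated[of b A' B'] p complements_zero[OF p(4)] by simp
  then have "3 * b + 2 \<le> 2 * pair_count A B b" using p(1) by linarith
  moreover have "b \<in> B" using p by (simp add: dilate_def)
  moreover have "3 * 1 + 1 \<le> 2 * pair_count A B 1"
    using pair_count_ge[OF 0(1), of 1] by simp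
  ultimately show ?case using 0(4) p(1) by (metis less_one not_less zero_less_one
    add_leD2 nat_1_add_1 not_less_zero linorder_neqE_nat)
next
  case (Suc N)
  obtain b A' B' where p: "b \<ge> 2" "A = inflate b A'" "B = dilate b B'"
    "complements A' B'" "infinite A'" "infinite B'" "1 \<in> B'"
    using complements_peel[OF Suc.prems] .
  have grow: "Suc N < b * n" if "n > N" for n
  proof -
    have "2 * n \<le> b * n" using p(1) by (rule mult_right_mono) simp
    then show ?thesis using that by linarith
  qed
  have IH: "(\<exists>n>N. 3 * n + 3 \<le> 2 * pair_count A' B' n) \<or>
    ((\<exists>n>N. n \<in> A' \<and> 3 * n + 2 \<le> 2 * pair_count A' B' n) \<and>
     (\<exists>n>N. n \<in> B' \<and> 3 * n + 1 \<le> 2 * pair_count A' B' n))"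
    using Suc.IH[OF complements_commute[OF p(4)] p(6,5,7)] by (simp add: pair_count_commute)
  have block_end: "pair_count A B (b * n + (b - 1)) = b * pair_count A' B' n" for n
    using pair_count_block_end[of b A' B' n] p by simp
  from IH show ?case
  proof (elim disjE conjE exE)
    fix n assume n: "N < n" "3 * n + 3 \<le> 2 * pair_count A' B' n"
    \<comment> \<open>At a block end \<open>3 * (n + 1)\<close> is multiplied by \<open>b\<close>
      just as the product is, so the first alternative persists for every \<open>b\<close>.\<close>
    then have "b * (3 * n + 3) \<le> b * (2 * pair_count A' B' n)" by (intro mult_left_mono) auto
    moreover have "b * (3 * n + 3) = 3 * (b * n + (b - 1)) + 3"
      using p(1) by (simp add: algebra_simps)
    ultimately have "3 * (b * n + (b - 1)) + 3 \<le> 2 * pair_count A B (b * n + (b - 1))"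
      using block_end[of n] by simp
    then show ?thesis using grow[OF n(1)] trans_less_add1 by blast
  next
    fix n m
    assume n: "N < n" "n \<in> A'" "3 * n + 2 \<le> 2 * pair_count A' B' n"
      and m: "N < m" "m \<in> B'" "3 * m + 1 \<le> 2 * pair_count A' B' m"
    \<comment> \<open>Block \<open>m\<close> is empty in \<open>A\<close>, so the block-end value is
      already taken at \<open>b * m\<close>, and the constant 1 becomes \<open>b\<close>.\<close>
    have "m \<notin> A'" using complements_disjoint[OF p(4) _ m(2)] m(1) by auto
    then have bm: "pair_count A B (b * m) = b * pair_count A' B' m"
      using pair_count_block_start[of b m A' B'] p by simp
    have "b * (3 * m + 1) \<le> b * (2 * pair_count A' B' m)" using m(3) by (intro mult_left_mono) auto
    then have start: "3 * (b * m) + b \<le> 2 * pair_count A B (b * m)"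
      using bm by (simp add: algebra_simps)
    show ?thesis
    proof (cases "b = 2")
      case False
      then have "3 * (b * m) + 3 \<le> 2 * pair_count A B (b * m)" using start p(1) by linarith
      then show ?thesis using grow[OF m(1)] by blast
    next
      case True
      \<comment> \<open>For \<open>b = 2\<close> the witnesses change places: \<open>2 * m\<close>
        gets the constant 2, and \<open>2 * n + 1\<close> gets \<open>2 * 2 - 3 = 1\<close>.\<close>
      have "b * m \<in> B" using p m by (simp add: dilate_def)
      moreover have "3 * (b * m) + 2 \<le> 2 * pair_count A B (b * m)" using start True by simp
      moreover have "2 * n + 1 \<in> A" using p True n by (simp add: inflate_def)
      moreover have "3 * (2 * n + 1) + 1 \<le> 2 * pair_count A B (2 * n + 1)"
        using block_end[of n] True n(3) by simp
      moreover have "Suc N < 2 * n + 1" using n by simp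
      ultimately show ?thesis using grow[OF m(1)] by blast
    qed
  qed
qed

text \<open>Either alternative of \<open>pair_count_large_aux\<close> yields such an
  \<open>n\<close> once the additive constant is dropped; the case \<open>1 \<in> B\<close> follows
  by symmetry.\<close>

lemma pair_count_large:
  assumes "complements A B" "infinite A" "infinite B"
  shows "\<exists>n>N. 3 * n \<le> 2 * pair_count A B n"
proof -
  have *: "\<exists>n>N. 3 * n \<le> 2 * pair_count C D n"
    if "complements C D" "infinite C" "infinite D" "1 \<in> C" for C D
    using pair_count_large_aux[OF that, of N] by (meson add_leE)
  show ?thesis
    using complements_one[OF assms(1)] *[OF assms]
      *[OF complements_commute[OF assms(1)] assms(3,2)]
    by (auto simp: pair_count_commute)
qed

section \<open>From integer bounds to limits\<close>

lemma count_ratio_eq: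
  assumes "x \<ge> 0"
  shows "count_ratio A B x = ereal (real (pair_count A B (nat \<lfloor>x\<rfloor>)) / x)"
proof -
  have "{s \<in> S. real s \<le> x} = S \<inter> {..nat \<lfloor>x\<rfloor>}" for S
    using assms by (auto simp: le_nat_iff le_floor_iff)
  then show ?thesis by (simp add: count_ratio_def counting_def pair_count_def cnt_def)
qed

text \<open>The constant \<open>d\<close> disappears after division by \<open>x\<close>, and
  \<open>c \<ge> 0\<close> lets the floor of \<open>x\<close> be replaced by
  \<open>x\<close>.\<close>

lemma Limsup_count_ratio_le:
  assumes "\<And>n. real (pair_count A B n) \<le> c * real n + d" "c \<ge> 0"
  shows "Limsup at_top (count_ratio A B) \<le> ereal c"
proof -
  have lim: "((\<lambda>x::real. ereal (c + d / x)) \<longlongrightarrow> ereal c) at_top"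
    using tendsto_add[OF tendsto_const[of c] tendsto_divide_0[OF tendsto_const[of d] 
       filterlim_at_top_imp_at_infinity[OF filterlim_ident]]] by simp
  have "\<forall>\<^sub>F x in at_top. count_ratio A B x \<le> ereal (c + d / x)"
    using eventually_gt_at_top[of "0::real"]
  proof eventually_elim
    case (elim x)
    have "c * real (nat \<lfloor>x\<rfloor>) \<le> c * x"
      using assms(2) elim by (intro mult_left_mono) (auto simp: of_nat_floor)
    then have "real (pair_count A B (nat \<lfloor>x\<rfloor>)) \<le> c * x + d"
      using assms(1)[of "nat \<lfloor>x\<rfloor>"] by linarith
    then have "real (pair_count A B (nat \<lfloor>x\<rfloor>)) / x \<le> (c * x + d) / x"
      using elim by (intro divide_right_mono) auto
    then show ?case using elim by (simp add: count_ratio_eq add_divide_distrib)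
  qed
  then have "Limsup at_top (count_ratio A B) \<le> Limsup at_top (\<lambda>x. ereal (c + d / x))"
    by (rule Limsup_mono)
  also have "\<dots> = ereal c" using lim by (intro lim_imp_Limsup) auto
  finally show ?thesis .
qed

text \<open>A smaller upper limit would keep the ratio below \<open>c\<close> from some point on, in
  particular at one of the given integers.\<close>

lemma Limsup_count_ratio_ge:
  assumes "\<And>N. \<exists>n>N. c * real n \<le> real (pair_count A B n)"
  shows "ereal c \<le> Limsup at_top (count_ratio A B)"
proof (rule ccontr)
  assume "\<not> ?thesis"
  then have "\<forall>\<^sub>F x in at_top. count_ratio A B x < ereal c"
    by (intro Limsup_lessD) simp
  then obtain x0 where x0: "\<And>x. x \<ge> x0 \<Longrightarrow> count_ratio A B x < ereal c"
    by (auto simp: eventually_at_top_linorder)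
  obtain n where n: "n > nat \<lceil>x0\<rceil>" "c * real n \<le> real (pair_count A B n)" using assms by blast
  have "x0 \<le> real n" using n(1) by linarith
  then have "real (pair_count A B n) / real n < c" using x0[of "real n"] by (simp add: count_ratio_eq)
  with n show False by (simp add: field_simps)
qed

lemma Liminf_count_ratio:
  assumes "complements A B" "infinite A" "infinite B"
  shows "Liminf at_top (count_ratio A B) = 1"
proof (rule antisym)
  have "\<forall>\<^sub>F x in at_top. 1 \<le> count_ratio A B x"
    using eventually_gt_at_top[of "0::real"]
  proof eventually_elim
    case (elim x)
    have "x \<le> real (nat \<lfloor>x\<rfloor> + 1)" using elim by linarith
    also have "\<dots> \<le> real (pair_count A B (nat \<lfloor>x\<rfloor>))" using pair_count_ge[OF assms(1)] of_nat_mono by blast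
    finally show ?case using elim by (simp add: count_ratio_eq one_ereal_def)
  qed
  then show "1 \<le> Liminf at_top (count_ratio A B)" by (rule Liminf_bounded)
  show "Liminf at_top (count_ratio A B) \<le> 1"
  proof (rule ereal_le_epsilon2)
    fix e :: real assume e: "e > 0"
    show "Liminf at_top (count_ratio A B) \<le> 1 + ereal e"
    proof (rule ccontr)
      assume "\<not> ?thesis"
      then have "\<forall>\<^sub>F x in at_top. 1 + ereal e < count_ratio A B x"
        by (intro less_LiminfD) simp
      then obtain x0 where x0: "\<And>x. x \<ge> x0 \<Longrightarrow> 1 + ereal e < count_ratio A B x"
        by (auto simp: eventually_at_top_linorder)
      \<comment> \<open>At such an \<open>n\<close> the ratio is \<open>1 + 1 / n\<close>, which is
        at most \<open>1 + e\<close> by \<open>n \<ge> 1 / e\<close>; the final \<open>+ 1\<close>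
        keeps \<open>n\<close> positive.\<close>
      obtain n where n: "n \<ge> nat \<lceil>x0\<rceil> + nat \<lceil>1 / e\<rceil> + 1" "pair_count A B n = n + 1"
        using pair_count_tight[OF assms] by blast
      have "x0 \<le> real n" "1 / e \<le> real n" "n > 0" using n(1) by linarith+
      then have "1 + e < real (n + 1) / real n"
        using x0[of "real n"] n(2) by (simp add: count_ratio_eq one_ereal_def)
      with \<open>n > 0\<close> \<open>1 / e \<le> real n\<close> e show False by (simp add: field_simps)
    qed
  qed
qed

section \<open>Mixed radix systems\<close>

text \<open>The radices are \<open>k i + 2\<close>, so that no positivity assumption is needed. The two sets of
  complements consist of the numbers whose digits vanish at odd, respectively even, positions.\<close>

function digit_alternating :: "(nat \<Rightarrow> nat) \<Rightarrow> bool \<Rightarrow> nat \<Rightarrow> bool" where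
  "digit_alternating k s n = (if n = 0 then True else
     (s \<or> (k 0 + 2) dvd n) \<and> digit_alternating (\<lambda>i. k (Suc i)) (\<not> s) (n div (k 0 + 2)))"
  by pat_completeness auto
termination by (relation "measure (\<lambda>(k, s, n). n)") auto

declare digit_alternating.simps [simp del]

text \<open>The flag \<open>s\<close> tells whether the lowest digit is free; it flips from each
  position to the next.\<close>

definition radix_set :: "(nat \<Rightarrow> nat) \<Rightarrow> bool \<Rightarrow> nat set" where
  "radix_set k s = {n. digit_alternating k s n}"

lemma radix_set_iff:
  "n \<in> radix_set k s \<longleftrightarrow> n = 0 \<or>
    (s \<or> (k 0 + 2) dvd n) \<and> n div (k 0 + 2) \<in> radix_set (\<lambda>i. k (Suc i)) (\<not> s)"
  unfolding radix_set_def mem_Collect_eq by (subst digit_alternating.simps) simp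

lemma zero_in_radix_set [simp]: "0 \<in> radix_set k s"
  by (simp add: radix_set_def digit_alternating.simps)

text \<open>Removing the lowest digit shifts the radices and flips the flag. Zero is treated
  separately because the digit recursion stops there.\<close>

lemma radix_set_True: "radix_set k True = inflate (k 0 + 2) (radix_set (\<lambda>i. k (Suc i)) False)"
proof (rule set_eqI)
  show "n \<in> radix_set k True \<longleftrightarrow> n \<in> inflate (k 0 + 2) (radix_set (\<lambda>i. k (Suc i)) False)" for n
    by (cases "n = 0") (simp_all add: inflate_def radix_set_iff[of n k True])
qed

lemma radix_set_False: "radix_set k False = dilate (k 0 + 2) (radix_set (\<lambda>i. k (Suc i)) True)"
proof (rule set_eqI)
  show "n \<in> radix_set k False \<longleftrightarrow> n \<in> dilate (k 0 + 2) (radix_set (\<lambda>i. k (Suc i)) True)" for n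
    by (cases "n = 0") (simp_all add: dilate_def radix_set_iff[of n k False])
qed

lemma one_in_radix_set_True: "1 \<in> radix_set k True"
  using radix_set_iff[of 1 k True] by simp

text \<open>Removing the lowest digit passes to the quotient of \<open>n\<close> by the first radix,
  with shifted radices and the sets exchanged; so the induction on \<open>n\<close> runs over all
  \<open>k\<close>.\<close>

lemma rep_count_radix_set: "rep_count (radix_set k True) (radix_set k False) n = 1"
proof (induction n arbitrary: k rule: less_induct)
  case (less n)
  show ?case
  proof (cases "n = 0")
    case True
    have "{(a, b). a \<in> radix_set k True \<and> b \<in> radix_set k False \<and> a + b = n} = {(0, 0)}"
      using True by auto
    then show ?thesis by (simp add: rep_count_def)
  next
    case False
    have "rep_count (radix_set k True) (radix_set k False) n
        = rep_count (radix_set (\<lambda>i. k (Suc i)) False) (radix_set (\<lambda>i. k (Suc i)) True) (n div (k 0 + 2))"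
      unfolding radix_set_True[of k] radix_set_False[of k]
      by (rule rep_count_inflate_dilate) simp
    also have "\<dots> = 1" using less.IH[of "n div (k 0 + 2)"] False by (simp add: rep_count_commute)
    finally show ?thesis .
  qed
qed

text \<open>Multiplication by the first radix prepends a zero digit, which either flag admits. The
  starting witnesses are 1 and the first radix.\<close>

lemma radix_set_unbounded: "\<exists>n>N. n \<in> radix_set k s"
proof (induction N arbitrary: k s)
  case 0
  have "k 0 + 2 \<in> radix_set k False"
    unfolding radix_set_False[of k] using one_in_radix_set_True by (simp add: dilate_def)
  then show ?case using one_in_radix_set_True by (cases s) (auto intro: exI[of _ "k 0 + 2"])
next
  case (Suc N)
  obtain n where n: "n > N" "n \<in> radix_set (\<lambda>i. k (Suc i)) (\<not> s)" using Suc by blast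
  then have "(k 0 + 2) * n \<in> radix_set k s"
    using radix_set_iff[of "(k 0 + 2) * n" k s] by (simp del: mult_Suc)
  moreover have "Suc N < (k 0 + 2) * n" using n(1) by (simp add: algebra_simps)
  ultimately show ?case by blast
qed

lemma infinite_radix_set: "infinite (radix_set k s)"
  unfolding infinite_nat_iff_unbounded using radix_set_unbounded by blast

text \<open>With all radices 2 the pair reproduces itself: \<open>A = inflate 2 B\<close> and
  \<open>B = dilate 2 A\<close>. The finer constants, 2 on \<open>B\<close> and 1 elsewhere, keep
  the additive error from doubling along the induction.\<close>

lemma pair_count_radix_set_binary:
  fixes A B :: "nat set"
  defines "A \<equiv> radix_set (\<lambda>_. 0) True" and "B \<equiv> radix_set (\<lambda>_. 0) False"
  shows "2 * pair_count A B n \<le> 3 * n + (if n \<in> B then 2 else 1)"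
proof (induction n rule: less_induct)
  case (less n)
  have A: "A = inflate 2 B" and B: "B = dilate 2 A"
    using radix_set_True[of "\<lambda>_. 0"] radix_set_False[of "\<lambda>_. 0"]
    by (simp_all add: A_def B_def numeral_2_eq_2)
  have comp: "complements A B" unfolding A_def B_def using rep_count_radix_set by blast
  have one: "1 \<in> A" "0 \<in> A" unfolding A_def using one_in_radix_set_True by auto
  show ?case
  proof (cases "n = 0")
    case True
    then show ?thesis using pair_count_zero[OF comp] complements_zero[OF comp] by simp
  next
    case False
    define m where "m = n div 2"
    have "m < n" using False by (simp add: m_def)
    note IH = less.IH[OF this]
    have odd: "pair_count A B (2 * m + 1) = 2 * pair_count A B m"
      using pair_count_block_end[of 2 B A m] unfolding A[symmetric] B[symmetric]
      by (simp add: pair_count_commute[of B])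
    show ?thesis
    proof (cases "even n")
      case n: False
      then have "n = 2 * m + 1" by (simp add: m_def)
      \<comment> \<open>Even the constant 2 at \<open>m\<close> suffices:
        \<open>2 * (3 * m + 2) = 3 * (2 * m + 1) + 1\<close>.\<close>
      then show ?thesis using odd IH by (auto split: if_splits)
    next
      case True
      then have n: "n = 2 * m" by (simp add: m_def)
      with False have "m > 0" by simp
      have nB: "n \<in> B \<longleftrightarrow> m \<in> A" using B n by (auto simp: dilate_def)
      show ?thesis
      proof (cases "m \<in> B")
        case mB: True
        then have "m \<notin> A" using complements_disjoint[OF comp] \<open>m > 0\<close> by auto
        \<comment> \<open>From \<open>2 * m\<close> to \<open>2 * m + 1\<close> the set
          \<open>A\<close> gains one element and \<open>B\<close> none, so the product at
          \<open>2 * m\<close> is smaller by \<open>cnt A m\<close>, at least 2. This pays for the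
          constant 2 at \<open>m\<close>.\<close>
        have "A \<inter> {..2 * m + 1} = insert (2 * m + 1) (A \<inter> {..2 * m})"
          using mB A by (auto simp: inflate_def)
        then have cA: "cnt A (2 * m + 1) = cnt A (2 * m) + 1" by (simp add: cnt_def)
        have cB: "cnt B (2 * m) = cnt A m" "cnt B (2 * m + 1) = cnt A m"
          using cnt_dilate[of 0 2 A m] cnt_dilate[of 1 2 A m] B by simp_all
        have "card {0, 1::nat} \<le> cnt A m" using one \<open>m > 0\<close> by (intro cnt_ge) auto
        then have "2 \<le> cnt A m" by simp
        moreover have "pair_count A B (2 * m) + cnt A m = pair_count A B (2 * m + 1)"
          unfolding pair_count_def cA cB by simp
        ultimately show ?thesis using odd IH n nB mB \<open>m \<notin> A\<close> by simp
      next
        case mB: False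
        then have pc: "pair_count A B n = 2 * pair_count A B m"
          using pair_count_block_start[of 2 m B A] n unfolding A[symmetric] B[symmetric]
          by (simp add: pair_count_commute[of B])
        show ?thesis
        proof (cases "m \<in> A")
          case True
          then show ?thesis using pc IH mB nB n by simp
        next
          case mA: False
          \<comment> \<open>Neither set has the element \<open>m\<close>, so the bound at
            \<open>l = m - 1\<close> applies, and its main term is smaller by 3.\<close>
          obtain l where l: "m = Suc l" using \<open>m > 0\<close> gr0_implies_Suc by blast
          have "S \<inter> {..m} = S \<inter> {..l}" if "m \<notin> S" for S
            using that l le_Suc_eq by auto
          then have "pair_count A B m = pair_count A B l"
            using mA mB by (simp add: pair_count_def cnt_def)
          moreover have "2 * pair_count A B l \<le> 3 * l + 2"
            using less.IH[of l] l \<open>m < n\<close> by (simp split: if_splits)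
          ultimately show ?thesis using pc n l nB mA by simp
        qed
      qed
    qed
  qed
qed

text \<open>With \<open>b = k j + 2\<close>, the system starting at position \<open>j\<close> has
  product at least \<open>2 * b\<close> at the argument \<open>b\<close>, that is
  \<open>2 * b / (b + 1)\<close> relative to \<open>n + 1\<close>. The \<open>j\<close> preceding
  digits preserve this quotient at block ends.\<close>

lemma pair_count_radix_set_ge:
  "\<exists>n\<ge>k j. 2 * (k j + 2) * (n + 1) \<le> (k j + 3) * pair_count (radix_set k True) (radix_set k False) n"
proof (induction j arbitrary: k)
  case 0
  have "2 * (k 0 + 2) \<le> pair_count (radix_set k True) (radix_set k False) (k 0 + 2)"
    unfolding radix_set_True[of k] radix_set_False[of k]
    by (rule pair_count_first_dilated[OF _ zero_in_radix_set zero_in_radix_set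
          one_in_radix_set_True]) simp
  then have "(k 0 + 3) * (2 * (k 0 + 2))
      \<le> (k 0 + 3) * pair_count (radix_set k True) (radix_set k False) (k 0 + 2)"
    by (rule mult_left_mono) simp
  then show ?case by (intro exI[of _ "k 0 + 2"]) (simp add: algebra_simps)
next
  case (Suc j)
  let ?k = "\<lambda>i. k (Suc i)" and ?b = "k 0 + 2"
  obtain n where n: "n \<ge> k (Suc j)" "2 * (k (Suc j) + 2) * (n + 1)
      \<le> (k (Suc j) + 3) * pair_count (radix_set ?k True) (radix_set ?k False) n"
    using Suc[of ?k] by blast
  let ?x = "?b * n + (?b - 1)" and ?g' = "pair_count (radix_set ?k True) (radix_set ?k False) n"
  have g: "pair_count (radix_set k True) (radix_set k False) ?x = ?b * ?g'"
    unfolding radix_set_True[of k] radix_set_False[of k]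
    by (subst pair_count_block_end) (simp_all add: pair_count_commute)
  have "2 * (k (Suc j) + 2) * (?x + 1) = ?b * (2 * (k (Suc j) + 2) * (n + 1))"
    by (simp add: algebra_simps)
  also have "\<dots> \<le> ?b * ((k (Suc j) + 3) * ?g')"
    using n(2) by (rule mult_left_mono) simp
  also have "\<dots> = (k (Suc j) + 3) * pair_count (radix_set k True) (radix_set k False) ?x"
    unfolding g by (rule mult.left_commute)
  finally have "2 * (k (Suc j) + 2) * (?x + 1)
      \<le> (k (Suc j) + 3) * pair_count (radix_set k True) (radix_set k False) ?x" .
  moreover have "k (Suc j) \<le> ?b * n + (?b - 1)" using n(1) by (simp add: algebra_simps)
  ultimately show ?case by blast
qed

section \<open>Upper limits and extremal pairs\<close>

lemma Limsup_count_ratio_le_2: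
  assumes "complements A B"
  shows "Limsup at_top (count_ratio A B) \<le> 2"
proof -
  have "real (pair_count A B n) \<le> 2 * real n + 1" for n
    using of_nat_mono[OF pair_count_le[OF assms, of n], where ?'a = real] by simp
  from Limsup_count_ratio_le[OF this] show ?thesis by simp
qed

lemma Limsup_count_ratio_ge_3_2:
  assumes "complements A B" "infinite A" "infinite B"
  shows "3 / 2 \<le> Limsup at_top (count_ratio A B)"
proof -
  have "\<exists>n>N. 3 / 2 * real n \<le> real (pair_count A B n)" for N
  proof -
    obtain n where n: "n > N" "3 * n \<le> 2 * pair_count A B n" using pair_count_large[OF assms] by blast
    then have "real (3 * n) \<le> real (2 * pair_count A B n)" using of_nat_mono by blast
    with n(1) show ?thesis by (intro exI[of _ n]) simp
  qed
  from Limsup_count_ratio_ge[OF this] show ?thesis by (simp add: numeral_eq_ereal)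
qed

lemma Limsup_count_ratio_binary:
  "Limsup at_top (count_ratio (radix_set (\<lambda>_. 0) True) (radix_set (\<lambda>_. 0) False)) = 3 / 2"
    (is "Limsup _ (count_ratio ?A ?B) = _")
proof (rule antisym)
  have "real (pair_count ?A ?B n) \<le> 3 / 2 * real n + 1" for n
  proof -
    have "2 * pair_count ?A ?B n \<le> 3 * n + 2"
      using pair_count_radix_set_binary[of n] by (simp split: if_splits)
    then have "real (2 * pair_count ?A ?B n) \<le> real (3 * n + 2)" using of_nat_mono by blast
    then show ?thesis by simp
  qed
  from Limsup_count_ratio_le[OF this] show "Limsup at_top (count_ratio ?A ?B) \<le> 3 / 2"
    by (simp add: numeral_eq_ereal)
qed (intro Limsup_count_ratio_ge_3_2 allI rep_count_radix_set infinite_radix_set)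

lemma Limsup_count_ratio_growing:
  "Limsup at_top (count_ratio (radix_set (\<lambda>i. i) True) (radix_set (\<lambda>i. i) False)) = 2"
    (is "Limsup _ (count_ratio ?A ?B) = _")
proof (rule antisym)
  show "Limsup at_top (count_ratio ?A ?B) \<le> 2"
    by (intro Limsup_count_ratio_le_2 allI rep_count_radix_set)
  have "ereal (2 - e) \<le> Limsup at_top (count_ratio ?A ?B)" if e: "e > 0" for e :: real
  proof (rule Limsup_count_ratio_ge)
    fix N
    \<comment> \<open>Large enough for \<open>2 / (j + 3) \<le> e\<close>, that is
      \<open>2 * (j + 2) / (j + 3) \<ge> 2 - e\<close>; the summand \<open>N + 1\<close> makes the
      argument exceed \<open>N\<close>.\<close>
    define j where "j = N + 1 + nat \<lceil>2 / e\<rceil>"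
    obtain n where n: "n \<ge> j" "2 * (j + 2) * (n + 1) \<le> (j + 3) * pair_count ?A ?B n"
      using pair_count_radix_set_ge[of "\<lambda>i. i" j] by auto
    have "2 / e \<le> real j" unfolding j_def by linarith
    then have "2 \<le> e * real j" using e by (simp add: field_simps)
    also have "\<dots> \<le> e * (real j + 3)" using e by simp
    finally have "(real j + 3) * (2 - e) \<le> 2 * (real j + 2)" by (simp add: algebra_simps)
    then have "(real j + 3) * (2 - e) * real n \<le> 2 * (real j + 2) * real n"
      by (rule mult_right_mono) simp
    also have "\<dots> \<le> 2 * (real j + 2) * (real n + 1)" by (rule mult_left_mono) auto
    also have "\<dots> = real (2 * (j + 2) * (n + 1))" by (simp add: algebra_simps)
    also have "\<dots> \<le> real ((j + 3) * pair_count ?A ?B n)" using n(2) of_nat_mono by blast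
    also have "\<dots> = (real j + 3) * real (pair_count ?A ?B n)" by simp
    finally have "(real j + 3) * ((2 - e) * real n) \<le> (real j + 3) * real (pair_count ?A ?B n)"
      by (simp only: mult.assoc)
    then have "(2 - e) * real n \<le> real (pair_count ?A ?B n)"
      by (rule mult_left_le_imp_le) simp
    moreover have "n > N" using n(1) j_def by simp
    ultimately show "\<exists>n>N. (2 - e) * real n \<le> real (pair_count ?A ?B n)" by blast
  qed
  then have "2 \<le> Limsup at_top (count_ratio ?A ?B) + ereal e" if "e > 0" for e :: real
    using that by (cases "Limsup at_top (count_ratio ?A ?B)") (force simp: numeral_eq_ereal)+
  then show "2 \<le> Limsup at_top (count_ratio ?A ?B)" by (rule ereal_le_epsilon2)
qed

theorem theorem3:
  shows "(\<forall>A B :: nat set. infinite A \<and> infinite B \<and> (\<forall>n. rep_count A B n = 1) \<longrightarrow>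
            Liminf at_top (count_ratio A B) = 1 \<and>
            3/2 \<le> Limsup at_top (count_ratio A B) \<and>
            Limsup at_top (count_ratio A B) \<le> 2) \<and>
         (\<exists>A B :: nat set. infinite A \<and> infinite B \<and> (\<forall>n. rep_count A B n = 1) \<and>
            Limsup at_top (count_ratio A B) = 3/2) \<and>
         (\<exists>A B :: nat set. infinite A \<and> infinite B \<and> (\<forall>n. rep_count A B n = 1) \<and>
            Limsup at_top (count_ratio A B) = 2)"
proof (intro conjI)
  show "\<forall>A B :: nat set. infinite A \<and> infinite B \<and> (\<forall>n. rep_count A B n = 1) \<longrightarrow>
      Liminf at_top (count_ratio A B) = 1 \<and>
      3/2 \<le> Limsup at_top (count_ratio A B) \<and>
      Limsup at_top (count_ratio A B) \<le> 2"
    by (intro allI impI conjI; elim conjE)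
      (rule Liminf_count_ratio Limsup_count_ratio_ge_3_2 Limsup_count_ratio_le_2; assumption)+
qed (use Limsup_count_ratio_binary Limsup_count_ratio_growing
      rep_count_radix_set infinite_radix_set in metis)+

end
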